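(* Let $f:(0,\infty)\to\mathbb{R}$ be a real-valued function in $L_1((0,\infty),dx)$ with Laplace transform $F(z)=\int_0^\infty f(x)e^{-zx}\,dx$, $\mathrm{Re}(z)\ge 0$. Let $M,p,n_\infty$ be positive integers, and suppose that there are real numbers $\xi_0,\dots,\xi_{n_\infty-1}$ such that $$f(x)=\sum_{j=0}^{n_\infty-1}\xi_j\frac{x^j}{j!}+O(x^{n_\infty}),\qquad x\to 0^+.$$ Let $z_1,\dots,z_p$ be distinct complex numbers with $\mathrm{Re}(z_j)\ge 0$ and $z_{p+1-j}=\overline{z_j}$ for all $j=1,\dots,p$. If $p+n_\infty=2M$, then there exists at most one rational function $R$ of the form $$R(z)=\sum_{j=1}^M\frac{c_j}{z+\lambda_j},\qquad c_j,\lambda_j\in\mathbb{C},$$ satisfying both of the following conditions: (i) $R(z_j)=F(z_j)$ for $j=1,2,\dots,p$; (ii) $R(z)=\sum_{j=0}^{n_\infty-1}\xi_j z^{-j-1}+O(z^{-n_\infty-1})$ as $z\to\infty$. Moreover, if such a rational function $R$ exists, it is necessarily real.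
   Context: Uniqueness refers to $R$ as a rational function (not to the ordering or choice of the parameters $c_j,\lambda_j$ representing it). Condition (i) includes the requirement that $R$ has no pole at any $z_j$. A rational function $R$ is called real if $R(z)=\overline{R(\overline z)}$ identically; equivalently, $R(z)\in\mathbb{R}$ for every $z\in\mathbb{R}$ that is not a pole of $R$. *)

theory Defs
  imports
    "HOL-Analysis.Analysis"
    "HOL-Library.Landau_Symbols"
    "HOL-Computational_Algebra.Computational_Algebra"
    "HOL-Computational_Algebra.Field_as_Ring"
begin

text \<open>
  A complex rational function is an element of the fraction field of the polynomial ring, so that
  equality is equality of rational functions. Poles and values are read off from the
  representation in lowest terms.
\<close>

type_synonym ratfun = "complex poly fract"

definition ratfun_pole :: "ratfun \<Rightarrow> complex \<Rightarrow> bool" where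
  "ratfun_pole R z \<longleftrightarrow> poly (snd (quot_of_fract R)) z = 0"

text \<open>At a pole the value below is the meaningless quotient by 0.\<close>

definition ratfun_eval :: "ratfun \<Rightarrow> complex \<Rightarrow> complex" where
  "ratfun_eval R z = poly (fst (quot_of_fract R)) z / poly (snd (quot_of_fract R)) z"

definition ratfun_real :: "ratfun \<Rightarrow> bool" where
  "ratfun_real R \<longleftrightarrow>
     (\<forall>z. \<not> ratfun_pole R z \<longrightarrow>
        \<not> ratfun_pole R (cnj z) \<and> ratfun_eval R z = cnj (ratfun_eval R (cnj z)))"

text \<open>The parameters need not be distinct, nor the coefficients nonzero.\<close>

definition partial_fraction_form :: "nat \<Rightarrow> ratfun \<Rightarrow> bool" where
  "partial_fraction_form M R \<longleftrightarrow>
     (\<exists>c l :: nat \<Rightarrow> complex. R = (\<Sum>j=1..M. Fraction_Field.Fract [:c j:] [:l j, 1:]))"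

definition laplace_transform :: "(real \<Rightarrow> real) \<Rightarrow> complex \<Rightarrow> complex" where
  "laplace_transform f z = (LINT x:{0<..}|lebesgue. of_real (f x) * exp (- (z * of_real x)))"

definition interpolates_at ::
    "nat \<Rightarrow> (nat \<Rightarrow> complex) \<Rightarrow> (complex \<Rightarrow> complex) \<Rightarrow> ratfun \<Rightarrow> bool" where
  "interpolates_at p z F R \<longleftrightarrow>
     (\<forall>j\<in>{1..p}. \<not> ratfun_pole R (z j) \<and> ratfun_eval R (z j) = F (z j))"

definition expands_at_infinity :: "nat \<Rightarrow> (nat \<Rightarrow> real) \<Rightarrow> ratfun \<Rightarrow> bool" where
  "expands_at_infinity n \<xi> R \<longleftrightarrow>
     (\<lambda>z. ratfun_eval R z - (\<Sum>j<n. of_real (\<xi> j) * z powi (- int j - 1)))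
       \<in> O[at_infinity](\<lambda>z. z powi (- int n - 1))"

lemma ratfun_Fract:
  assumes "poly b z \<noteq> 0"
  shows "\<not> ratfun_pole (Fraction_Field.Fract a b) z"
    and "ratfun_eval (Fraction_Field.Fract a b) z = poly a z / poly b z"
proof -
  have "b \<noteq> 0" using assms by auto
  have q: "quot_of_fract (Fraction_Field.Fract a b) = normalize_quot (a, b)"
    using quot_of_fract_quot_to_fract[of "(a, b)"] \<open>b \<noteq> 0\<close>
    by (simp add: quot_to_fract_def)
  obtain d where "a = fst (normalize_quot (a, b)) * d" "b = snd (normalize_quot (a, b)) * d"
    using normalize_quotE[OF \<open>b \<noteq> 0\<close>] by metis
  then have a: "poly a z = poly (fst (normalize_quot (a, b))) z * poly d z"
    and b: "poly b z = poly (snd (normalize_quot (a, b))) z * poly d z"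
    by (metis poly_mult)+
  show "\<not> ratfun_pole (Fraction_Field.Fract a b) z"
    using assms b by (auto simp: ratfun_pole_def q)
  show "ratfun_eval (Fraction_Field.Fract a b) z = poly a z / poly b z"
    using assms unfolding ratfun_eval_def q a b by auto
qed

end

theory Submission
  imports Defs
begin

text \<open>
  Let \<open>a\<^sub>1/b\<^sub>1\<close> and \<open>a\<^sub>2/b\<^sub>2\<close> be two candidates in lowest terms. Their denominators have degree at most
  \<open>M\<close>, so uniqueness comes from counting zeros of the single polynomial
  \<open>D = a\<^sub>1 b\<^sub>2 - a\<^sub>2 b\<^sub>1\<close>. Each of the \<open>p\<close> interpolation nodes is a zero of \<open>D\<close>. On the other hand
  \<open>D = (a\<^sub>1/b\<^sub>1 - a\<^sub>2/b\<^sub>2) b\<^sub>1 b\<^sub>2\<close>, and the common expansion at infinity makes the first factor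
  \<open>O(z\<^sup>-\<^sup>n\<^sup>-\<^sup>1)\<close>, whence \<open>D = O(z\<^sup>2\<^sup>M\<^sup>-\<^sup>n\<^sup>-\<^sup>1) = O(z\<^sup>p\<^sup>-\<^sup>1)\<close>. A polynomial of degree below \<open>p\<close> with \<open>p\<close>
  distinct zeros vanishes, so the two rational functions coincide (\<open>ratfun_eqI_interpolation\<close>).

  Reality is a consequence of uniqueness. The conjugate \<open>z \<mapsto> cnj (R (cnj z))\<close> satisfies the same
  conditions as \<open>R\<close>: the nodes form a conjugation-invariant set on which \<open>F (cnj z) = cnj (F z)\<close>
  because \<open>f\<close> is real-valued, and the coefficients of the expansion are real. Hence it is equal
  to \<open>R\<close>.

  The partial fraction form enters through the bound \<open>M\<close> on the degree of the denominator, which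
  conjugating the coefficients of numerator and denominator visibly preserves.
\<close>

section \<open>Growth of polynomials at infinity\<close>

lemma eventually_poly_nonzero_at_infinity:
  fixes b :: "complex poly"
  assumes "b \<noteq> 0"
  shows "eventually (\<lambda>z. poly b z \<noteq> 0) at_infinity"
proof -
  have "eventually (\<lambda>z. poly b z / z ^ degree b \<noteq> 0) at_infinity"
    using assms by (intro tendsto_imp_eventually_ne[OF poly_divide_tendsto_aux]) simp
  then show ?thesis by eventually_elim auto
qed

lemma poly_bigo_at_infinity:
  fixes b :: "complex poly"
  assumes "degree b \<le> M"
  shows "poly b \<in> O[at_infinity](\<lambda>z. z ^ M)"
proof -
  have nz: "eventually (\<lambda>z::complex. z \<noteq> 0) at_infinity"
    by (rule eventually_at_infinityI[of 1]) auto
  have "poly b \<in> O[at_infinity](\<lambda>z. z ^ degree b)"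
    by (rule bigoI_tendsto[OF poly_divide_tendsto_aux], use nz in eventually_elim) simp
  also have "(\<lambda>z::complex. z ^ degree b) \<in> O[at_infinity](\<lambda>z. z ^ M)"
    by (rule bigoI[of _ 1], rule eventually_at_infinityI[of 1])
       (use assms in \<open>auto simp: norm_power intro: power_increasing\<close>)
  finally show ?thesis .
qed

text \<open>
  If the degree of \<open>D\<close> exceeded \<open>k\<close>, then \<open>z\<^sup>k\<close> would be of smaller order than \<open>D\<close>, so that \<open>D\<close> would
  be of smaller order than itself.
\<close>

lemma degree_le_if_bigo_at_infinity:
  fixes D :: "complex poly"
  assumes "poly D \<in> O[at_infinity](\<lambda>z. z ^ k)"
  shows "degree D \<le> k"
proof (rule ccontr)
  assume "\<not> degree D \<le> k"
  then have deg: "degree D > k" and D0: "D \<noteq> 0" by auto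
  have nz: "eventually (\<lambda>z. poly D z \<noteq> 0) at_infinity"
    using D0 by (rule eventually_poly_nonzero_at_infinity)
  have "((\<lambda>z. poly (monom 1 k) z / poly D z) \<longlongrightarrow> 0) at_infinity"
    by (rule poly_divide_tendsto_0_at_infinity) (use deg in \<open>simp add: degree_monom_eq\<close>)
  then have "(\<lambda>z. z ^ k) \<in> o[at_infinity](poly D)"
    by (intro smalloI_tendsto) (use nz in \<open>auto simp: poly_monom\<close>)
  with assms have "poly D \<in> o[at_infinity](poly D)"
    by (rule landau_o.big_small_trans)
  then have "eventually (\<lambda>z. poly D z = 0) at_infinity"
    by (simp add: landau_o.small_refl_iff)
  with nz have "eventually (\<lambda>z::complex. False) at_infinity"
    by eventually_elim simp
  then show False by (simp add: eventually_False trivial_limit_at_infinity)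
qed

section \<open>Denominators in lowest terms\<close>

lemma degree_snd_quot_of_fract_le:
  fixes b :: "complex poly"
  assumes "b \<noteq> 0"
  shows "degree (snd (quot_of_fract (Fraction_Field.Fract a b))) \<le> degree b"
proof -
  have q: "quot_of_fract (Fraction_Field.Fract a b) = normalize_quot (a, b)"
    using quot_of_fract_quot_to_fract[of "(a, b)"] assms by (simp add: quot_to_fract_def)
  obtain d where "b = snd (normalize_quot (a, b)) * d"
    using normalize_quotE[OF assms] by metis
  then show ?thesis
    using assms by (metis dvd_triv_left dvd_imp_degree_le q)
qed

text \<open>
  The product of all the linear denominators is a common denominator of degree \<open>M\<close>; coinciding
  parameters can only lower the degree after cancellation.
\<close>

lemma partial_fraction_form_degree_le:
  assumes "partial_fraction_form M R"
  shows "degree (snd (quot_of_fract R)) \<le> M"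
proof -
  obtain c l :: "nat \<Rightarrow> complex" where
    R: "R = (\<Sum>j=1..M. Fraction_Field.Fract [:c j:] [:l j, 1:])"
    using assms by (auto simp: partial_fraction_form_def)
  have "\<exists>a b. b \<noteq> 0 \<and> degree b \<le> m \<and>
          (\<Sum>j=1..m. Fraction_Field.Fract [:c j:] [:l j, 1:]) = Fraction_Field.Fract a b" for m
  proof (induction m)
    case 0
    show ?case
      by (intro exI[of _ 0] exI[of _ 1]) (simp add: Zero_fract_def)
  next
    case (Suc m)
    then obtain a b where ab: "b \<noteq> 0" "degree b \<le> m"
      "(\<Sum>j=1..m. Fraction_Field.Fract [:c j:] [:l j, 1:]) = Fraction_Field.Fract a b"
      by blast
    have "degree (b * [:l (Suc m), 1:]) \<le> Suc m"
      by (rule order_trans[OF degree_mult_le]) (use ab in simp)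
    moreover have "b * [:l (Suc m), 1:] \<noteq> 0"
      using ab by (metis mult_eq_0_iff pCons_eq_0_iff zero_neq_one)
    moreover have "(\<Sum>j=1..Suc m. Fraction_Field.Fract [:c j:] [:l j, 1:])
        = Fraction_Field.Fract (a * [:l (Suc m), 1:] + [:c (Suc m):] * b) (b * [:l (Suc m), 1:])"
      using ab by simp
    ultimately show ?case by blast
  qed
  then obtain a b where "b \<noteq> 0" "degree b \<le> M" "R = Fraction_Field.Fract a b"
    unfolding R by blast
  then show ?thesis
    using degree_snd_quot_of_fract_le order_trans by blast
qed

section \<open>Uniqueness of the interpolant\<close>

text \<open>
  The nodes supply \<open>p\<close> zeros of the cross difference \<open>D\<close> of the two fractions, one more than its
  growth at infinity permits for a nonzero polynomial.
\<close>

lemma ratfun_eqI_interpolation: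
  assumes deg1: "degree (snd (quot_of_fract R1)) \<le> M"
    and deg2: "degree (snd (quot_of_fract R2)) \<le> M"
    and int1: "interpolates_at p z F R1" and int2: "interpolates_at p z F R2"
    and exp1: "expands_at_infinity n \<xi> R1" and exp2: "expands_at_infinity n \<xi> R2"
    and inj: "inj_on z {1..p}" and "p > 0" and "p + n = 2 * M"
  shows "R1 = R2"
proof -
  define a1 b1 a2 b2 where "a1 = fst (quot_of_fract R1)" "b1 = snd (quot_of_fract R1)"
    "a2 = fst (quot_of_fract R2)" "b2 = snd (quot_of_fract R2)"
  note ab = this
  define D where "D = a1 * b2 - a2 * b1"
  have b0: "b1 \<noteq> 0" "b2 \<noteq> 0" by (simp_all add: ab)
  have roots: "poly D w = 0" if "w \<in> z ` {1..p}" for w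
  proof -
    have nz: "poly b1 w \<noteq> 0" "poly b2 w \<noteq> 0"
      and "poly a1 w / poly b1 w = poly a2 w / poly b2 w"
      using that int1 int2
      by (auto simp: interpolates_at_def ratfun_pole_def ratfun_eval_def ab)
    then show ?thesis by (simp add: D_def divide_simps)
  qed
  have nz: "eventually (\<lambda>w. poly b1 w \<noteq> 0) at_infinity"
    "eventually (\<lambda>w. poly b2 w \<noteq> 0) at_infinity"
    "eventually (\<lambda>w::complex. w \<noteq> 0) at_infinity"
    using b0 by (auto intro: eventually_poly_nonzero_at_infinity eventually_at_infinityI[of 1])
  have diff: "(\<lambda>w. ratfun_eval R1 w - ratfun_eval R2 w)
      \<in> O[at_infinity](\<lambda>w. w powi (- int n - 1))"
    using sum_in_bigo(2)[OF exp1[unfolded expands_at_infinity_def]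
                            exp2[unfolded expands_at_infinity_def]]
    by simp
  have "poly D \<in> O[at_infinity](\<lambda>w. (ratfun_eval R1 w - ratfun_eval R2 w) * (poly b1 w * poly b2 w))"
    by (rule bigoI[of _ 1], use nz(1,2) in eventually_elim)
       (simp add: D_def ratfun_eval_def flip: ab, simp add: field_simps)
  also have "(\<lambda>w. (ratfun_eval R1 w - ratfun_eval R2 w) * (poly b1 w * poly b2 w))
      \<in> O[at_infinity](\<lambda>w. w powi (- int n - 1) * (w ^ M * w ^ M))"
    using deg1 deg2 by (intro landau_o.big.mult diff poly_bigo_at_infinity) (simp_all add: ab)
  also have "(\<lambda>w::complex. w powi (- int n - 1) * (w ^ M * w ^ M)) \<in> O[at_infinity](\<lambda>w. w ^ (p - 1))"
  proof (rule bigoI[of _ 1], use nz(3) in eventually_elim)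
    case (elim w)
    have "w powi (- int n - 1) * (w ^ M * w ^ M) = w powi (- int n - 1 + int (M + M))"
      using elim by (simp only: power_int_add power_add power_int_of_nat simp_thms)
    also have "- int n - 1 + int (M + M) = int (p - 1)"
      using assms by simp
    finally show ?case by (simp add: power_int_of_nat)
  qed
  finally have "degree D \<le> p - 1"
    by (rule degree_le_if_bigo_at_infinity)
  have "D = 0"
  proof (rule ccontr)
    assume "D \<noteq> 0"
    have "p = card (z ` {1..p})" using inj by (simp add: card_image)
    also have "\<dots> \<le> card {w. poly D w = 0}"
      using roots \<open>D \<noteq> 0\<close> by (intro card_mono poly_roots_finite) auto
    also have "\<dots> \<le> degree D" using \<open>D \<noteq> 0\<close> by (rule card_poly_roots_bound)
    finally show False using \<open>degree D \<le> p - 1\<close> \<open>p > 0\<close> by simp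
  qed
  then have "Fraction_Field.Fract a1 b1 = Fraction_Field.Fract a2 b2"
    using b0 by (simp add: D_def eq_fract)
  then show ?thesis by (simp add: ab)
qed

section \<open>Conjugation\<close>

text \<open>
  Conjugation commutes with the integral and fixes the real values of \<open>f\<close>. At a point where the
  integral diverges both sides have the default value 0.
\<close>

lemma laplace_transform_cnj: "laplace_transform f (cnj w) = cnj (laplace_transform f w)"
  unfolding laplace_transform_def set_lebesgue_integral_def Bochner_Integration.integral_cnj[symmetric]
  by (intro Bochner_Integration.integral_cong) (simp_all add: exp_cnj)

text \<open>This is the rational function \<open>z \<mapsto> cnj (R (cnj z))\<close>.\<close>

definition ratfun_cnj :: "ratfun \<Rightarrow> ratfun" where
  "ratfun_cnj R = Fraction_Field.Fract (map_poly cnj (fst (quot_of_fract R)))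
                                       (map_poly cnj (snd (quot_of_fract R)))"

lemma ratfun_cnj_at:
  assumes "\<not> ratfun_pole R (cnj w)"
  shows "\<not> ratfun_pole (ratfun_cnj R) w"
    and "ratfun_eval (ratfun_cnj R) w = cnj (ratfun_eval R (cnj w))"
proof -
  have "poly (map_poly cnj (snd (quot_of_fract R))) w \<noteq> 0"
    using assms by (simp add: ratfun_pole_def)
  from ratfun_Fract[OF this]
  show "\<not> ratfun_pole (ratfun_cnj R) w"
    and "ratfun_eval (ratfun_cnj R) w = cnj (ratfun_eval R (cnj w))"
    by (simp_all add: ratfun_cnj_def ratfun_eval_def)
qed

lemma degree_snd_quot_of_fract_ratfun_cnj:
  "degree (snd (quot_of_fract (ratfun_cnj R))) \<le> degree (snd (quot_of_fract R))"
proof -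
  have deg: "degree (map_poly cnj (snd (quot_of_fract R))) = degree (snd (quot_of_fract R))"
    by (rule degree_map_poly) simp
  have "map_poly cnj (snd (quot_of_fract R)) \<noteq> 0"
    by (subst map_poly_eq_0_iff) auto
  then show ?thesis
    unfolding ratfun_cnj_def using degree_snd_quot_of_fract_le deg by metis
qed

lemma interpolates_at_ratfun_cnj:
  assumes int: "interpolates_at p z F R"
    and sym: "\<And>j. j \<in> {1..p} \<Longrightarrow> z (p + 1 - j) = cnj (z j)"
    and F: "\<And>w. F (cnj w) = cnj (F w)"
  shows "interpolates_at p z F (ratfun_cnj R)"
  unfolding interpolates_at_def
proof (intro ballI)
  fix j assume j: "j \<in> {1..p}"
  then have "p + 1 - j \<in> {1..p}" by auto
  with int sym[OF j]
  have "\<not> ratfun_pole R (cnj (z j))" "ratfun_eval R (cnj (z j)) = F (cnj (z j))"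
    by (auto simp: interpolates_at_def simp flip: sym[OF j])
  then show "\<not> ratfun_pole (ratfun_cnj R) (z j) \<and> ratfun_eval (ratfun_cnj R) (z j) = F (z j)"
    by (simp add: ratfun_cnj_at F)
qed

text \<open>
  Since the \<open>\<xi> j\<close> are real, the remainder of the conjugate at \<open>z\<close> is the conjugate of the remainder of
  \<open>R\<close> at \<open>cnj z\<close>, apart from the finitely many \<open>z\<close> for which \<open>cnj z\<close> is a pole of \<open>R\<close>.
\<close>

lemma expands_at_infinity_ratfun_cnj:
  assumes "expands_at_infinity n \<xi> R"
  shows "expands_at_infinity n \<xi> (ratfun_cnj R)"
proof -
  let ?E = "\<lambda>R w. ratfun_eval R w - (\<Sum>j<n. of_real (\<xi> j) * w powi (- int j - 1))"
  have lim: "filterlim cnj at_infinity at_infinity"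
    by (rule filterlim_norm_at_top_imp_at_infinity)
       (simp add: filterlim_norm_at_top)
  have "eventually (\<lambda>w. poly (snd (quot_of_fract R)) w \<noteq> 0) at_infinity"
    by (rule eventually_poly_nonzero_at_infinity) simp
  from eventually_compose_filterlim[OF this lim]
  have "eventually (\<lambda>w. \<not> ratfun_pole R (cnj w)) at_infinity"
    by (simp add: ratfun_pole_def)
  then have ev: "eventually (\<lambda>w. norm (?E (ratfun_cnj R) w) = norm (?E R (cnj w))) at_infinity"
  proof eventually_elim
    case (elim w)
    have "?E (ratfun_cnj R) w = cnj (?E R (cnj w))"
      by (simp add: ratfun_cnj_at[OF elim] cnj_sum)
    then show ?case by (simp only: complex_mod_cnj)
  qed
  have "?E (ratfun_cnj R) \<in> O[at_infinity](\<lambda>w. ?E R (cnj w))"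
    by (rule bigoI[of _ 1], use ev in eventually_elim) simp
  also have "(\<lambda>w. ?E R (cnj w)) \<in> O[at_infinity](\<lambda>w. (cnj w) powi (- int n - 1))"
    using landau_o.big.compose[OF assms[unfolded expands_at_infinity_def] lim] .
  also have "(\<lambda>w. (cnj w) powi (- int n - 1)) \<in> O[at_infinity](\<lambda>w. w powi (- int n - 1))"
    by (rule bigoI[of _ 1]) (simp add: norm_power_int)
  finally show ?thesis
    by (simp only: expands_at_infinity_def)
qed

lemma ratfun_real_if_fixed:
  assumes "ratfun_cnj R = R"
  shows "ratfun_real R"
  unfolding ratfun_real_def
proof (intro allI impI)
  fix w assume "\<not> ratfun_pole R w"
  with ratfun_cnj_at[of R "cnj w"]
  show "\<not> ratfun_pole R (cnj w) \<and> ratfun_eval R w = cnj (ratfun_eval R (cnj w))"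
    by (simp add: assms)
qed

section \<open>Uniqueness and reality\<close>

theorem proposition1:
  fixes f :: "real \<Rightarrow> real" and M p n :: nat and \<xi> :: "nat \<Rightarrow> real" and z :: "nat \<Rightarrow> complex"
  assumes "set_integrable lebesgue {0<..} f"
    and "M > 0" and "p > 0" and "n > 0"
    and "(\<lambda>x. f x - (\<Sum>j<n. \<xi> j * (x ^ j / fact j))) \<in> O[at_right 0](\<lambda>x. x ^ n)"
    and "inj_on z {1..p}"
    and "\<And>j. j \<in> {1..p} \<Longrightarrow> Re (z j) \<ge> 0"
    and "\<And>j. j \<in> {1..p} \<Longrightarrow> z (p + 1 - j) = cnj (z j)"
    and "p + n = 2 * M"
  shows "(\<exists>\<^sub>\<le>\<^sub>1 R. partial_fraction_form M R \<and> interpolates_at p z (laplace_transform f) R \<and>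
            expands_at_infinity n \<xi> R) \<and>
         (\<forall>R. partial_fraction_form M R \<and> interpolates_at p z (laplace_transform f) R \<and>
            expands_at_infinity n \<xi> R \<longrightarrow> ratfun_real R)"
proof (intro conjI Uniq_I allI impI; elim conjE)
  fix R1 R2
  assume "partial_fraction_form M R1" "interpolates_at p z (laplace_transform f) R1"
    "expands_at_infinity n \<xi> R1" "partial_fraction_form M R2"
    "interpolates_at p z (laplace_transform f) R2" "expands_at_infinity n \<xi> R2"
  then show "R2 = R1"
    using assms(3,6,9) partial_fraction_form_degree_le ratfun_eqI_interpolation by metis
next
  fix R
  assume R: "partial_fraction_form M R" "interpolates_at p z (laplace_transform f) R"
    "expands_at_infinity n \<xi> R"
  have deg: "degree (snd (quot_of_fract R)) \<le> M"
    using R(1) by (rule partial_fraction_form_degree_le)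
  have "ratfun_cnj R = R"
  proof (rule ratfun_eqI_interpolation)
    show "degree (snd (quot_of_fract (ratfun_cnj R))) \<le> M"
      using degree_snd_quot_of_fract_ratfun_cnj deg by (rule order_trans)
    show "interpolates_at p z (laplace_transform f) (ratfun_cnj R)"
      using R(2) assms(8) laplace_transform_cnj by (rule interpolates_at_ratfun_cnj)
    show "expands_at_infinity n \<xi> (ratfun_cnj R)"
      using R(3) by (rule expands_at_infinity_ratfun_cnj)
  qed (use deg R assms in auto)
  then show "ratfun_real R" by (rule ratfun_real_if_fixed)
qed

end
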